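(* Let $A=(f_1,\dots,f_k)$ be a system of $k$ tropical polynomials in $n$ variables and let $x\in\mathbb{R}^n$ be a solution of $A$. Then $x$ is a generalized vertex of $A$ if and only if one can choose $2n$ monomials $m_{i,j}$, $1\le i\le n$, $1\le j\le 2$ (the same monomial may be chosen several times) such that: (1) for each $i$, the monomials $m_{i,1}$ and $m_{i,2}$ are marked with a star in $A^{*x}$ in the same row (i.e. for one and the same polynomial of $A$, which may depend on $i$); (2) the linear span of the vectors $v_n(m_{1,1},m_{1,2}),\,v_n(m_{2,1},m_{2,2}),\dots,v_n(m_{n,1},m_{n,2})$ has dimension $n$.
   Context: A tropical polynomial $f$ in $n$ variables is given by a nonempty finite set of tropical monomials $Q_j(x)=a_j+i_{j1}x_1+\cdots+i_{jn}x_n$ with $a_j\in\mathbb{R}$ and pairwise distinct exponent vectors $(i_{j1},\dots,i_{jn})\in\mathbb{Z}_{\ge 0}^n$; $f(x)=\min_j Q_j(x)$. A point $x\in\mathbb{R}^n$ is a tropical zero of $f$ if $\min_j Q_j(x)$ is attained for at least two different $j$; a solution of $A$ is a point of $\mathbb{R}^n$ that is a tropical zero of every $f_i$. Star table: for $x\in\mathbb{R}^n$, $A^{*x}$ is the table whose rows correspond to the polynomials of $A$ and whose columns correspond to the monomials (exponent vectors) in $n$ variables; the entry $(i,m)$ carries a star if and only if the monomial with exponent vector $m$ occurs in $f_i$ and attains at $x$ the minimal value among all monomials of $f_i$. Star tables are ordered by inclusion of their sets of starred entries. A point $x$ is a generalized vertex of $A$ if for every point $y\ne x$ of $\mathbb{R}^n$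 the table $A^{*y}$ does not contain $A^{*x}$. For tropical monomials $m_1,m_2$ in $n$ variables with exponent vectors $p_n(m_1),p_n(m_2)\in\mathbb{Z}^n_{\ge 0}$, put $v_n(m_1,m_2)=p_n(m_2)-p_n(m_1)\in\mathbb{R}^n$. *)

theory Defs
  imports "HOL-Analysis.Analysis"
begin

text \<open>
  A monomial in the variables indexed by \<open>'n\<close> is identified with its exponent vector. A tropical
  polynomial is a partial map sending the exponent vector of each of its monomials to the
  coefficient \<open>a\<close> of that monomial; pairwise distinctness of the exponent vectors is thus built in.
\<close>

type_synonym 'n monomial = "nat ^ 'n"
type_synonym 'n tpoly = "'n monomial \<rightharpoonup> real"

definition tropical_polynomial :: "'n::finite tpoly \<Rightarrow> bool" where
  "tropical_polynomial f \<longleftrightarrow> finite (dom f) \<and> dom f \<noteq> {}"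

definition exponent_vector :: "'n::finite monomial \<Rightarrow> real ^ 'n" where
  "exponent_vector m = (\<chi> j. real (m $ j))"

text \<open>Only meaningful for \<open>m \<in> dom f\<close>.\<close>

definition monomial_value :: "'n::finite tpoly \<Rightarrow> 'n monomial \<Rightarrow> real ^ 'n \<Rightarrow> real" where
  "monomial_value f m x = the (f m) + (\<Sum>j\<in>UNIV. real (m $ j) * x $ j)"

definition tropical_eval :: "'n::finite tpoly \<Rightarrow> real ^ 'n \<Rightarrow> real" where
  "tropical_eval f x = Min ((\<lambda>m. monomial_value f m x) ` dom f)"

definition attains_min :: "'n::finite tpoly \<Rightarrow> real ^ 'n \<Rightarrow> 'n monomial \<Rightarrow> bool" where
  "attains_min f x m \<longleftrightarrow> m \<in> dom f \<and> monomial_value f m x = tropical_eval f x"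

definition tropical_zero :: "'n::finite tpoly \<Rightarrow> real ^ 'n \<Rightarrow> bool" where
  "tropical_zero f x \<longleftrightarrow> (\<exists>m m'. m \<noteq> m' \<and> attains_min f x m \<and> attains_min f x m')"

definition is_solution :: "'n::finite tpoly list \<Rightarrow> real ^ 'n \<Rightarrow> bool" where
  "is_solution A x \<longleftrightarrow> (\<forall>f\<in>set A. tropical_zero f x)"

text \<open>
  A star table is represented by its set of starred entries, so that containment of tables is \<open>\<subseteq>\<close>.
  Rows are the positions \<open>0, \<dots>, length A - 1\<close> in the list, columns are all monomials.
\<close>

definition star_table :: "'n::finite tpoly list \<Rightarrow> real ^ 'n \<Rightarrow> (nat \<times> 'n monomial) set" where
  "star_table A x = {(r, m). r < length A \<and> attains_min (A ! r) x m}"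

definition generalized_vertex :: "'n::finite tpoly list \<Rightarrow> real ^ 'n \<Rightarrow> bool" where
  "generalized_vertex A x \<longleftrightarrow> (\<forall>y. y \<noteq> x \<longrightarrow> \<not> star_table A x \<subseteq> star_table A y)"

definition monomial_diff :: "'n::finite monomial \<Rightarrow> 'n monomial \<Rightarrow> real ^ 'n" where
  "monomial_diff m m' = exponent_vector m' - exponent_vector m"

end

theory Submission
  imports Defs
begin

text \<open>
  Let \<open>D\<close> be the set of differences of exponent vectors of pairs of monomials starred at \<open>x\<close> in a
  common row. The reason behind the theorem is that the points \<open>y\<close> near \<open>x\<close> with
  \<open>star_table A x \<subseteq> star_table A y\<close> are exactly those near \<open>x\<close> with \<open>y - x\<close> orthogonal to \<open>D\<close>.

  If all stars of \<open>x\<close> survive at \<open>y\<close>, then two monomials sharing a row take equal values both at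
  \<open>x\<close> and at \<open>y\<close>; subtracting, their exponent difference kills \<open>y - x\<close>
  (\<open>star_table_mono_imp_orthogonal\<close>). For this direction \<open>y\<close> may be far away. Conversely, moving from
  \<open>x\<close> in a direction \<open>z\<close> orthogonal to \<open>D\<close> keeps the minimal monomials of each row tied among
  themselves, while the strictly larger ones stay larger for a short time, since there are only
  finitely many of them (\<open>orthogonal_direction_keeps_stars\<close>). Hence \<open>x\<close> is a generalized vertex iff
  no nonzero vector is orthogonal to \<open>D\<close>, that is iff \<open>D\<close> spans the whole space
  (\<open>generalized_vertex_iff_span\<close>). The remaining step is linear algebra: a spanning set
  contains a basis, and its \<open>n\<close> elements are the differences to choose.
\<close>

definition starred_differences :: "'n::finite tpoly list \<Rightarrow> real ^ 'n \<Rightarrow> (real ^ 'n) set" where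
  "starred_differences A x =
    {monomial_diff m m' | r m m'. (r, m) \<in> star_table A x \<and> (r, m') \<in> star_table A x}"

lemma monomial_value_inner: "monomial_value f m x = the (f m) + exponent_vector m \<bullet> x"
  by (simp add: monomial_value_def exponent_vector_def inner_vec_def)

lemma attains_min_iff:
  assumes "tropical_polynomial f"
  shows "attains_min f x m \<longleftrightarrow>
    m \<in> dom f \<and> (\<forall>m'\<in>dom f. monomial_value f m x \<le> monomial_value f m' x)"
proof -
  let ?V = "(\<lambda>m. monomial_value f m x) ` dom f"
  have fin: "finite ?V" "?V \<noteq> {}"
    using assms by (simp_all add: tropical_polynomial_def)
  have "monomial_value f m x = tropical_eval f x \<longleftrightarrow>
      (\<forall>m'\<in>dom f. monomial_value f m x \<le> monomial_value f m' x)" if "m \<in> dom f"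
  proof -
    have "monomial_value f m x \<in> ?V"
      using that by (rule imageI)
    then show ?thesis
      unfolding tropical_eval_def eq_Min_iff[OF fin] by blast
  qed
  then show ?thesis
    unfolding attains_min_def by blast
qed

lemma star_table_mono_imp_orthogonal:
  assumes sub: "star_table A x \<subseteq> star_table A y" and d: "d \<in> starred_differences A x"
  shows "d \<bullet> (y - x) = 0"
proof -
  obtain r m m' where d_eq: "d = monomial_diff m m'"
    and x: "(r, m) \<in> star_table A x" "(r, m') \<in> star_table A x"
    using d unfolding starred_differences_def by blast
  have y: "(r, m) \<in> star_table A y" "(r, m') \<in> star_table A y"
    using x sub by auto
  have "monomial_value (A ! r) m x = monomial_value (A ! r) m' x"
    "monomial_value (A ! r) m y = monomial_value (A ! r) m' y"
    using x y by (simp_all add: star_table_def attains_min_def)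
  then show ?thesis
    by (simp add: d_eq monomial_value_inner monomial_diff_def inner_diff_left inner_diff_right)
qed

text \<open>
  Ties persist along \<open>z\<close> exactly and strict inequalities persist by continuity; finiteness of
  the rows and of each polynomial makes one bound on \<open>t\<close> serve for all comparisons.
\<close>

lemma orthogonal_direction_keeps_stars:
  fixes x z :: "real ^ 'n::finite"
  assumes poly: "\<forall>f\<in>set A. tropical_polynomial f"
    and orth: "\<And>d. d \<in> starred_differences A x \<Longrightarrow> d \<bullet> z = 0"
  shows "\<forall>\<^sub>F t in at_right 0. star_table A x \<subseteq> star_table A (x + t *\<^sub>R z)"
proof -
  have cmp: "\<forall>\<^sub>F t in at_right 0. (r, m) \<in> star_table A x \<longrightarrow>
      monomial_value (A ! r) m (x + t *\<^sub>R z) \<le> monomial_value (A ! r) m' (x + t *\<^sub>R z)"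
    if r: "r < length A" and m': "m' \<in> dom (A ! r)" for r m m'
  proof (cases "(r, m) \<in> star_table A x")
    case star: True
    have tp: "tropical_polynomial (A ! r)"
      using poly r by simp
    show ?thesis
    proof (cases "(r, m') \<in> star_table A x")
      case True
      have "monomial_diff m m' \<bullet> z = 0"
        using star True by (intro orth) (auto simp: starred_differences_def)
      moreover have "monomial_value (A ! r) m x = monomial_value (A ! r) m' x"
        using star True by (simp add: star_table_def attains_min_def)
      ultimately show ?thesis
        by (intro always_eventually)
          (auto simp: monomial_value_inner monomial_diff_def inner_diff_left inner_add_right)
    next
      case False
      have "monomial_value (A ! r) m x < monomial_value (A ! r) m' x"
        using star False r m'
        unfolding star_table_def mem_Collect_eq case_prod_conv attains_min_iff[OF tp]
        by (meson not_less order_trans)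
      moreover have "((\<lambda>t. monomial_value (A ! r) p (x + t *\<^sub>R z)) \<longlongrightarrow> monomial_value (A ! r) p x)
          (at_right 0)" for p
        unfolding monomial_value_inner by (auto intro!: tendsto_eq_intros)
      ultimately have "\<forall>\<^sub>F t in at_right 0.
          0 < monomial_value (A ! r) m' (x + t *\<^sub>R z) - monomial_value (A ! r) m (x + t *\<^sub>R z)"
        by (intro order_tendstoD(1)[OF tendsto_diff]) auto
      then show ?thesis
        by eventually_elim simp
    qed
  qed simp
  have fin: "finite (dom (A ! r))" if "r < length A" for r
    using poly that by (simp add: tropical_polynomial_def)
  have "\<forall>\<^sub>F t in at_right 0. \<forall>r\<in>{..<length A}. \<forall>m\<in>dom (A ! r). \<forall>m'\<in>dom (A ! r).
      (r, m) \<in> star_table A x \<longrightarrow>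
      monomial_value (A ! r) m (x + t *\<^sub>R z) \<le> monomial_value (A ! r) m' (x + t *\<^sub>R z)"
    using fin cmp by (intro eventually_ball_finite ballI) auto
  then show ?thesis
  proof eventually_elim
    case (elim t)
    show ?case
    proof (intro subrelI)
      fix r m
      assume rm: "(r, m) \<in> star_table A x"
      then have r: "r < length A" and m: "m \<in> dom (A ! r)"
        by (auto simp: star_table_def attains_min_def)
      have "tropical_polynomial (A ! r)"
        using poly r by simp
      then show "(r, m) \<in> star_table A (x + t *\<^sub>R z)"
        using elim rm r m by (simp add: star_table_def attains_min_iff)
    qed
  qed
qed

text \<open>
  A vertex is a point from which no direction is free, and the free directions form the orthogonal
  complement of the starred differences.
\<close>

lemma generalized_vertex_iff_span:
  fixes x :: "real ^ 'n::finite"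
  assumes poly: "\<forall>f\<in>set A. tropical_polynomial f"
  shows "generalized_vertex A x \<longleftrightarrow> span (starred_differences A x) = UNIV"
proof
  assume vertex: "generalized_vertex A x"
  show "span (starred_differences A x) = UNIV"
  proof (rule ccontr)
    assume "span (starred_differences A x) \<noteq> UNIV"
    then obtain z where z: "z \<noteq> 0" "\<And>d. d \<in> span (starred_differences A x) \<Longrightarrow> z \<bullet> d = 0"
      using span_not_UNIV_orthogonal by blast
    have "\<forall>\<^sub>F t in at_right 0. star_table A x \<subseteq> star_table A (x + t *\<^sub>R z)"
      using z(2) by (intro orthogonal_direction_keeps_stars poly) (metis inner_commute span_base)
    then have "\<forall>\<^sub>F t in at_right (0::real). t > 0 \<and> star_table A x \<subseteq> star_table A (x + t *\<^sub>R z)"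
      using eventually_at_right_less by (rule eventually_conj[rotated])
    then obtain t :: real where "t > 0" "star_table A x \<subseteq> star_table A (x + t *\<^sub>R z)"
      using eventually_happens'[OF trivial_limit_at_right_real] by blast
    then show False
      using vertex z(1) by (auto simp: generalized_vertex_def)
  qed
next
  assume full: "span (starred_differences A x) = UNIV"
  show "generalized_vertex A x"
    unfolding generalized_vertex_def
  proof (intro allI impI notI)
    fix y
    assume "y \<noteq> x" and sub: "star_table A x \<subseteq> star_table A y"
    have "orthogonal (y - x) d" if "d \<in> starred_differences A x" for d
      using star_table_mono_imp_orthogonal[OF sub that] by (simp add: orthogonal_def inner_commute)
    then have "orthogonal (y - x) (y - x)"
      using full by (intro orthogonal_to_span[of "y - x" "starred_differences A x"]) auto
    then show False
      using \<open>y \<noteq> x\<close> by (simp add: orthogonal_def)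
  qed
qed

theorem theorem4p11:
  fixes A :: "'n::finite tpoly list" and x :: "real ^ 'n"
  assumes "\<forall>f\<in>set A. tropical_polynomial f"
    and "is_solution A x"
  shows "generalized_vertex A x \<longleftrightarrow>
    (\<exists>m :: nat \<Rightarrow> nat \<Rightarrow> 'n monomial.
      (\<forall>i\<in>{1..CARD('n)}. \<exists>r. (r, m i 1) \<in> star_table A x \<and> (r, m i 2) \<in> star_table A x) \<and>
      dim (span ((\<lambda>i. monomial_diff (m i 1) (m i 2)) ` {1..CARD('n)})) = CARD('n))"
  unfolding generalized_vertex_iff_span[OF assms(1)]
proof
  let ?D = "starred_differences A x"
  assume full: "span ?D = UNIV"
  obtain B where B: "B \<subseteq> ?D" "independent B" "?D \<subseteq> span B" "card B = dim ?D"
    using basis_exists by blast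
  have card: "card B = CARD('n)"
    using B(4) full by (metis dim_span dim_UNIV DIM_cart DIM_real mult_1_right)
  have "\<exists>h. bij_betw h {1..CARD('n)} B"
    using card B(2) by (intro finite_same_card_bij independent_imp_finite) auto
  then obtain h where h: "bij_betw h {1..CARD('n)} B" ..
  have "\<exists>p r. (r, fst p) \<in> star_table A x \<and> (r, snd p) \<in> star_table A x \<and>
      h i = monomial_diff (fst p) (snd p)" if "i \<in> {1..CARD('n)}" for i
  proof -
    have "h i \<in> ?D"
      using B(1) h that by (auto simp: bij_betw_def)
    then show ?thesis
      unfolding starred_differences_def by auto
  qed
  then obtain p where p: "\<And>i. i \<in> {1..CARD('n)} \<Longrightarrow>
      (\<exists>r. (r, fst (p i)) \<in> star_table A x \<and> (r, snd (p i)) \<in> star_table A x) \<and>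
      h i = monomial_diff (fst (p i)) (snd (p i))"
    by metis
  define m where "m i j = (if j = (1::nat) then fst (p i) else snd (p i))" for i j
  have "(\<lambda>i. monomial_diff (m i 1) (m i 2)) ` {1..CARD('n)} = h ` {1..CARD('n)}"
    using p by (intro image_cong) (auto simp: m_def)
  also have "\<dots> = B"
    using h by (simp add: bij_betw_def)
  finally have "dim (span ((\<lambda>i. monomial_diff (m i 1) (m i 2)) ` {1..CARD('n)})) = CARD('n)"
    using card B(2) by (simp add: dim_eq_card_independent)
  moreover have "\<forall>i\<in>{1..CARD('n)}. \<exists>r. (r, m i 1) \<in> star_table A x \<and> (r, m i 2) \<in> star_table A x"
    using p by (simp add: m_def)
  ultimately show "\<exists>m :: nat \<Rightarrow> nat \<Rightarrow> 'n monomial.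
      (\<forall>i\<in>{1..CARD('n)}. \<exists>r. (r, m i 1) \<in> star_table A x \<and> (r, m i 2) \<in> star_table A x) \<and>
      dim (span ((\<lambda>i. monomial_diff (m i 1) (m i 2)) ` {1..CARD('n)})) = CARD('n)"
    by blast
next
  let ?D = "starred_differences A x"
  assume "\<exists>m :: nat \<Rightarrow> nat \<Rightarrow> 'n monomial.
      (\<forall>i\<in>{1..CARD('n)}. \<exists>r. (r, m i 1) \<in> star_table A x \<and> (r, m i 2) \<in> star_table A x) \<and>
      dim (span ((\<lambda>i. monomial_diff (m i 1) (m i 2)) ` {1..CARD('n)})) = CARD('n)"
  then obtain m :: "nat \<Rightarrow> nat \<Rightarrow> 'n monomial" where
    m: "\<forall>i\<in>{1..CARD('n)}. \<exists>r. (r, m i 1) \<in> star_table A x \<and> (r, m i 2) \<in> star_table A x"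
    and dim: "dim (span ((\<lambda>i. monomial_diff (m i 1) (m i 2)) ` {1..CARD('n)})) = CARD('n)"
    by blast
  have "span ((\<lambda>i. monomial_diff (m i 1) (m i 2)) ` {1..CARD('n)}) = UNIV"
    using dim by (subst dim_eq_full[symmetric]) simp
  moreover have "(\<lambda>i. monomial_diff (m i 1) (m i 2)) ` {1..CARD('n)} \<subseteq> ?D"
    using m unfolding starred_differences_def by blast
  ultimately show "span ?D = UNIV"
    using span_mono by blast
qed

end
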